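(* For every positive integer $k$, the path $P_{4k+3}$ is not determined by its Hermitian spectrum (not DHS).
   Context: A mixed graph has undirected edges and directed edges (ordered pairs $(x,y)$). For vertices $v_1,\dots,v_n$, its Hermitian adjacency matrix $H(X)$ has $(j,k)$ entry $1$ if $v_jv_k$ is an undirected edge, $i$ if $(v_j,v_k)$ is a directed edge, $-i$ if $(v_k,v_j)$ is a directed edge, $0$ otherwise; $\mathrm{Spec}_H(X)$ is its multiset of eigenvalues. Mixed graphs $X,Y$ on the same vertex set are switching equivalent if $H(X)=D^{-1}H(Y)D$ for a diagonal $D$ with diagonal entries in $\{\pm1,\pm i\}$. A mixed graph $X$ is DHS if every mixed graph $Y$ with $\mathrm{Spec}_H(Y)=\mathrm{Spec}_H(X)$ is switching equivalent to a mixed graph isomorphic to $X$. $P_n$ is the path on $n$ vertices with all edges undirected. *)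

theory Defs
  imports "Jordan_Normal_Form.Char_Poly"
begin

record 'a mixed_graph =
  verts :: "'a set"
  edges :: "'a set set"
  arcs :: "('a \<times> 'a) set"

text \<open>
  Finite mixed graphs without loops; any two vertices are joined by at most one undirected
  edge or arc, so a mixed graph is a simple graph some of whose edges have been directed.
\<close>

definition mixed_graph :: "'a mixed_graph \<Rightarrow> bool" where
  "mixed_graph X \<longleftrightarrow>
     finite (verts X) \<and>
     (\<forall>e\<in>edges X. e \<subseteq> verts X \<and> card e = 2) \<and>
     arcs X \<subseteq> verts X \<times> verts X \<and>
     (\<forall>x y. (x, y) \<in> arcs X \<longrightarrow> x \<noteq> y \<and> (y, x) \<notin> arcs X \<and> {x, y} \<notin> edges X)"

definition herm_entry :: "'a mixed_graph \<Rightarrow> 'a \<Rightarrow> 'a \<Rightarrow> complex" where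
  "herm_entry X u v =
     (if {u, v} \<in> edges X then 1
      else if (u, v) \<in> arcs X then \<i>
      else if (v, u) \<in> arcs X then - \<i>
      else 0)"

text \<open>
  Rows and columns are indexed by the vertices in increasing order. The order only serves to
  fix one enumeration for each vertex set; other enumerations conjugate the matrix by a
  permutation matrix.
\<close>

definition herm_adj :: "('a :: linorder) mixed_graph \<Rightarrow> complex mat" where
  "herm_adj X =
     (let vs = sorted_list_of_set (verts X); n = card (verts X)
      in mat n n (\<lambda>(j, k). herm_entry X (vs ! j) (vs ! k)))"

definition Spec_H :: "('a :: linorder) mixed_graph \<Rightarrow> complex multiset" where
  "Spec_H X = proots (char_poly (herm_adj X))"

definition switching_equivalent ::
  "('a :: linorder) mixed_graph \<Rightarrow> 'a mixed_graph \<Rightarrow> bool" where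
  "switching_equivalent X Y \<longleftrightarrow>
     verts X = verts Y \<and>
     (let n = card (verts X) in
      \<exists>D \<in> carrier_mat n n. \<exists>D' \<in> carrier_mat n n.
        diagonal_mat D \<and> (\<forall>j<n. D $$ (j, j) \<in> {1, -1, \<i>, - \<i>}) \<and>
        inverts_mat D D' \<and> inverts_mat D' D \<and>
        herm_adj X = D' * herm_adj Y * D)"

definition isomorphic :: "'a mixed_graph \<Rightarrow> 'b mixed_graph \<Rightarrow> bool" where
  "isomorphic X Y \<longleftrightarrow>
     (\<exists>f. bij_betw f (verts X) (verts Y) \<and>
        (\<forall>u\<in>verts X. \<forall>v\<in>verts X.
           ({u, v} \<in> edges X \<longleftrightarrow> {f u, f v} \<in> edges Y) \<and>
           ((u, v) \<in> arcs X \<longleftrightarrow> (f u, f v) \<in> arcs Y)))"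

text \<open>
  Letting \<open>Y\<close> range only over the vertex type of \<open>X\<close> loses nothing: equal spectra force
  equally many vertices, so every \<open>Y\<close> has an isomorphic copy on the vertices of \<open>X\<close>.
\<close>

definition DHS :: "('a :: linorder) mixed_graph \<Rightarrow> bool" where
  "DHS X \<longleftrightarrow>
     (\<forall>Y :: 'a mixed_graph. mixed_graph Y \<and> Spec_H Y = Spec_H X \<longrightarrow>
        (\<exists>Z. mixed_graph Z \<and> switching_equivalent Y Z \<and> isomorphic Z X))"

definition path :: "nat \<Rightarrow> nat mixed_graph" where
  "path n = \<lparr>verts = {0..<n}, edges = {{j, Suc j} | j. Suc j < n}, arcs = {}\<rparr>"

lemma mixed_graph_path: "mixed_graph (path n)"
  by (auto simp: mixed_graph_def path_def)

end

theory Submission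
  imports Defs
begin

text \<open>
  Let \<open>Y\<close> arise from \<open>P\<^bsub>4k+3\<^esub>\<close> by removing the middle edge and closing the upper half to
  a cycle by an arc, so \<open>Y\<close> is the disjoint union of \<open>P\<^bsub>2k+1\<^esub>\<close> and a cycle of length
  \<open>2k+2\<close> of weight \<open>\<i>\<close>. Both graphs have the \<open>4k+3\<close> distinct eigenvalues
  \<open>2 cos (s\<pi> / (4k+4))\<close>, \<open>1 \<le> s \<le> 4k+3\<close>: for even \<open>s\<close> a sine vector on the short path,
  extended by zero, is an eigenvector of \<open>Y\<close>, and for odd \<open>s\<close> a geometric progression on the
  cycle is. Switching and isomorphism preserve adjacency, hence connectedness, and \<open>Y\<close> is
  disconnected.
\<close>

section \<open>Spectra from sufficiently many distinct eigenvalues\<close>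

text \<open>Each eigenvalue in \<open>S\<close> is a root of positive order, so
  \<open>mset_set S\<close> is contained in the multiset of roots. The degree bounds the size of
  that multiset by \<open>n\<close>, which leaves no room for further roots or higher
  multiplicities.\<close>

lemma proots_char_poly_eq_mset_set:
  fixes A :: "'a :: field mat"
  assumes A: "A \<in> carrier_mat n n" and S: "finite S" "card S = n"
    and ev: "\<And>x. x \<in> S \<Longrightarrow> eigenvalue A x"
  shows "proots (char_poly A) = mset_set S"
proof -
  have deg: "degree (char_poly A) = n" "char_poly A \<noteq> 0"
    using degree_monic_char_poly[OF A] by auto
  have "mset_set S \<subseteq># proots (char_poly A)"
  proof (rule mset_subset_eqI)
    fix x
    show "count (mset_set S) x \<le> count (proots (char_poly A)) x"
    proof (cases "x \<in> S")
      case True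
      then have "poly (char_poly A) x = 0"
        using ev eigenvalue_root_char_poly[OF A] by blast
      then have "order x (char_poly A) \<noteq> 0"
        using deg by (simp add: order_root)
      then show ?thesis using True S deg by simp
    qed (use S in simp)
  qed
  moreover have "size (proots (char_poly A)) \<le> size (mset_set S)"
    using size_proots_le[of "char_poly A"] deg S by simp
  ultimately show ?thesis
    by (metis mset_subset_size not_less subset_mset.le_less)
qed

lemma herm_adj_atLeast0LessThan:
  "verts X = {0..<n} \<Longrightarrow> herm_adj X = mat n n (\<lambda>(j, k). herm_entry X j k)"
  by (auto simp: herm_adj_def Let_def intro!: eq_matI)

text \<open>Lets candidate eigenvectors be plain functions on indices, tested by row sums; the value
  at \<open>u0\<close> rules out the zero vector.\<close>

lemma eigenvalue_herm_adj:
  fixes X :: "nat mixed_graph"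
  assumes X: "verts X = {0..<n}" and nz: "u0 < n" "f u0 \<noteq> 0"
    and eq: "\<And>u. u < n \<Longrightarrow> (\<Sum>w\<in>{0..<n}. herm_entry X u w * f w) = x * f u"
  shows "eigenvalue (herm_adj X) x"
proof -
  have "vec n f \<noteq> 0\<^sub>v n"
    using nz by (metis index_vec index_zero_vec(1))
  moreover have "herm_adj X *\<^sub>v vec n f = x \<cdot>\<^sub>v vec n f"
    using eq by (intro eq_vecI) (auto simp: herm_adj_atLeast0LessThan[OF X] scalar_prod_def)
  ultimately show ?thesis
    unfolding eigenvalue_def eigenvector_def
    by (intro exI[of _ "vec n f"]) (simp add: herm_adj_atLeast0LessThan[OF X])
qed

section \<open>Adjacency entries of the path and of its cospectral mate\<close>

lemma herm_entry_path:
  "u < n \<Longrightarrow> w < n \<Longrightarrow> herm_entry (path n) u w = (if w = Suc u \<or> u = Suc w then 1 else 0)"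
  by (auto simp: herm_entry_def path_def doubleton_eq_iff)

text \<open>The vertices up to \<open>2 * k\<close> carry the short path, those from
  \<open>2 * k + 1\<close> on the cycle; the only arc leads from the last vertex of the cycle back
  to its first.\<close>

definition path_cycle :: "nat \<Rightarrow> nat mixed_graph" where
  "path_cycle k = \<lparr>verts = {0..<4 * k + 3},
     edges = {{j, Suc j} | j. Suc j < 4 * k + 3 \<and> j \<noteq> 2 * k},
     arcs = {(4 * k + 2, 2 * k + 1)}\<rparr>"

lemma verts_path_cycle: "verts (path_cycle k) = {0..<4 * k + 3}"
  by (simp add: path_cycle_def)

lemma edges_path_cycle_iff:
  "{u, w} \<in> edges (path_cycle k) \<longleftrightarrow>
    w = Suc u \<and> w < 4 * k + 3 \<and> u \<noteq> 2 * k \<or> u = Suc w \<and> u < 4 * k + 3 \<and> w \<noteq> 2 * k"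
  by (auto simp: path_cycle_def doubleton_eq_iff)

lemma arcs_path_cycle_iff: "(u, w) \<in> arcs (path_cycle k) \<longleftrightarrow> u = 4 * k + 2 \<and> w = 2 * k + 1"
  by (simp add: path_cycle_def)

lemma mixed_graph_path_cycle:
  assumes "k \<ge> 1"
  shows "mixed_graph (path_cycle k)"
  unfolding mixed_graph_def
proof (intro conjI ballI allI impI)
  fix e assume "e \<in> edges (path_cycle k)"
  then obtain j where "e = {j, Suc j}" "Suc j < 4 * k + 3"
    by (auto simp: path_cycle_def)
  then show "e \<subseteq> verts (path_cycle k)" "card e = 2"
    by (simp_all add: verts_path_cycle)
next
  fix x y assume "(x, y) \<in> arcs (path_cycle k)"
  then have "x = 4 * k + 2" "y = 2 * k + 1" by (simp_all add: arcs_path_cycle_iff)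
  \<comment> \<open>For \<open>k \<ge> 1\<close> the cycle has length at least 4, so the closing arc
    does not join consecutive vertices and cannot lie over an edge.\<close>
  with assms show "x \<noteq> y" "(y, x) \<notin> arcs (path_cycle k)" "{x, y} \<notin> edges (path_cycle k)"
    by (simp_all add: arcs_path_cycle_iff edges_path_cycle_iff)
qed (simp_all add: path_cycle_def)

lemma herm_entry_path_cycle:
  assumes "u < 4 * k + 3" "w < 4 * k + 3"
  shows "herm_entry (path_cycle k) u w =
    (if w = Suc u \<and> u \<noteq> 2 * k \<or> u = Suc w \<and> w \<noteq> 2 * k then 1
     else if u = 4 * k + 2 \<and> w = 2 * k + 1 then \<i>
     else if w = 4 * k + 2 \<and> u = 2 * k + 1 then - \<i> else 0)"
proof -
  have "{u, w} \<in> edges (path_cycle k) \<longleftrightarrow>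
      w = Suc u \<and> u \<noteq> 2 * k \<or> u = Suc w \<and> w \<noteq> 2 * k"
    unfolding edges_path_cycle_iff using assms by blast
  then show ?thesis
    by (simp only: herm_entry_def arcs_path_cycle_iff)
qed

text \<open>This is the disconnectedness of the mate: the test \<open>u \<le> 2 * k\<close> singles
  out the short path. The one consecutive pair that straddles the boundary is the removed edge, and
  both ends of the arc lie above it.\<close>

lemma herm_entry_path_cycle_nonzero:
  assumes k: "k \<ge> 1" and uw: "u < 4 * k + 3" "w < 4 * k + 3"
    and nz: "herm_entry (path_cycle k) u w \<noteq> 0"
  shows "w \<le> 2 * k \<longleftrightarrow> u \<le> 2 * k"
proof -
  have "w = Suc u \<and> u \<noteq> 2 * k \<or> u = Suc w \<and> w \<noteq> 2 * k \<or> u = 4 * k + 2 \<and> w = 2 * k + 1 \<or>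
    w = 4 * k + 2 \<and> u = 2 * k + 1"
    using nz unfolding herm_entry_path_cycle[OF uw] by presburger
  then show ?thesis by (elim disjE) auto
qed

section \<open>Matrix rows as sums over neighbours\<close>

lemma sum_eq_two_terms:
  fixes h f :: "nat \<Rightarrow> 'a :: comm_ring_1"
  assumes "a < n" "b < n" "a \<noteq> b" "\<And>w. w < n \<Longrightarrow> w \<noteq> a \<Longrightarrow> w \<noteq> b \<Longrightarrow> h w = 0"
  shows "(\<Sum>w\<in>{0..<n}. h w * f w) = h a * f a + h b * f b"
proof -
  have "(\<Sum>w\<in>{0..<n}. h w * f w) = (\<Sum>w\<in>{a, b}. h w * f w)"
    using assms by (intro sum.mono_neutral_right) auto
  with assms show ?thesis by simp
qed

lemma sum_herm_entry_path:
  assumes "u < n"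
  shows "(\<Sum>w\<in>{0..<n}. herm_entry (path n) u w * f w) =
    (if u = 0 then 0 else f (u - 1)) + (if Suc u < n then f (Suc u) else 0)"
proof -
  have "(\<Sum>w\<in>{0..<n}. herm_entry (path n) u w * f w) =
      (\<Sum>w\<in>(if u = 0 then {} else {u - 1}) \<union> (if Suc u < n then {Suc u} else {}).
         herm_entry (path n) u w * f w)"
    using assms by (intro sum.mono_neutral_right) (auto simp: herm_entry_path)
  then show ?thesis using assms by (auto simp: herm_entry_path)
qed

text \<open>The two summands come from the predecessor and the successor within the component. On
  the cycle they wrap around through the arc, whose weight is \<open>\<i>\<close> seen from its tail
  and \<open>- \<i>\<close> seen from its head.\<close>

lemma sum_herm_entry_path_cycle:
  assumes k: "k \<ge> 1" and u: "u < 4 * k + 3"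
  shows "(\<Sum>w\<in>{0..<4 * k + 3}. herm_entry (path_cycle k) u w * f w) =
    (if u = 0 then 0 else if u = 2 * k + 1 then - \<i> * f (4 * k + 2) else f (u - 1)) +
    (if u = 2 * k then 0 else if u = 4 * k + 2 then \<i> * f (2 * k + 1) else f (Suc u))"
    (is "?S = _")
proof -
  note entry = herm_entry_path_cycle
  note two = sum_eq_two_terms[of _ "4 * k + 3" _ "herm_entry (path_cycle k) u" f]
  consider "u = 0" | "u = 2 * k" "u > 0" | "u = 2 * k + 1" | "u = 4 * k + 2"
    | "u \<notin> {0, 2 * k, 2 * k + 1, 4 * k + 2}"
    using k by auto
  then show ?thesis
  proof cases
    case 1
    \<comment> \<open>An end of the short path has a single neighbour. The vertex itself, with
      diagonal entry 0, fills the other slot, here and in the next case.\<close>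
    have "?S = herm_entry (path_cycle k) u 0 * f 0 + herm_entry (path_cycle k) u 1 * f 1"
      by (rule two) (use 1 k in \<open>simp_all add: entry\<close>)
    with 1 k show ?thesis by (simp add: entry)
  next
    case 2
    have "?S = herm_entry (path_cycle k) u (u - 1) * f (u - 1) + herm_entry (path_cycle k) u u * f u"
      by (rule two) (use 2 k in \<open>simp_all add: entry\<close>)
    with 2 k show ?thesis by (simp add: entry)
  next
    case 3
    have "?S = herm_entry (path_cycle k) u (4 * k + 2) * f (4 * k + 2) +
        herm_entry (path_cycle k) u (Suc u) * f (Suc u)"
      by (rule two) (use 3 k in \<open>simp_all add: entry\<close>)
    with 3 k show ?thesis by (simp add: entry)
  next
    case 4
    have "?S = herm_entry (path_cycle k) u (u - 1) * f (u - 1) +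
        herm_entry (path_cycle k) u (2 * k + 1) * f (2 * k + 1)"
      by (rule two) (use 4 k in \<open>simp_all add: entry\<close>)
    with 4 k show ?thesis by (simp add: entry)
  next
    case 5
    then have "u - 1 < 4 * k + 3" "Suc u < 4 * k + 3" "u = Suc (u - 1)" "u - 1 \<noteq> 2 * k"
      using u by auto
    note u5 = 5 this
    have "?S = herm_entry (path_cycle k) u (u - 1) * f (u - 1) +
        herm_entry (path_cycle k) u (Suc u) * f (Suc u)"
      by (rule two) (use u5 in \<open>auto simp: entry\<close>)
    with u5 show ?thesis by (simp add: entry)
  qed
qed

section \<open>Trigonometry of the common spectrum\<close>

text \<open>The outer angles are the middle one minus and plus \<open>t\<close>, so the addition
  formulas apply. This three-term recurrence is the eigenvector equation at an inner vertex of a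
  path.\<close>

lemma sin_plus_sin_Suc_Suc:
  "sin (real u * t) + sin (real (Suc (Suc u)) * t) = 2 * cos t * sin (real (Suc u) * t)"
proof -
  have "sin (real u * t) = sin (real (Suc u) * t - t)"
    "sin (real (Suc (Suc u)) * t) = sin (real (Suc u) * t + t)"
    by (simp_all add: algebra_simps)
  then show ?thesis by (simp add: sin_add sin_diff)
qed

definition path_angle :: "nat \<Rightarrow> nat \<Rightarrow> real" where
  "path_angle n s = real s * pi / real (n + 1)"

lemma path_angle_bounds:
  assumes "s \<in> {1..n}"
  shows "0 < path_angle n s" "path_angle n s < pi"
proof -
  have "0 < real s" "real s < real (n + 1)" using assms by auto
  then show "0 < path_angle n s" "path_angle n s < pi"
    by (simp_all add: path_angle_def divide_less_eq)
qed

text \<open>All angles lie in the interval from 0 to pi, where cosine is injective. This supplies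
  the distinctness needed to count eigenvalues.\<close>

lemma inj_on_cos_path_angle:
  "inj_on (\<lambda>s. complex_of_real (2 * cos (path_angle n s))) {1..n}"
proof (rule inj_onI)
  fix s t assume st: "s \<in> {1..n}" "t \<in> {1..n}"
    and "complex_of_real (2 * cos (path_angle n s)) = complex_of_real (2 * cos (path_angle n t))"
  then have "cos (path_angle n s) = cos (path_angle n t)"
    by (simp only: of_real_eq_iff)
  then have "path_angle n s = path_angle n t"
    using path_angle_bounds[OF st(1)] path_angle_bounds[OF st(2)]
      cos_inj_pi[of "path_angle n s" "path_angle n t"] by simp
  then show "s = t" by (simp add: path_angle_def)
qed

text \<open>Reduces cospectrality to eigenvectors: the right-hand side depends only on
  \<open>n\<close>, so it serves as the common value of both spectra.\<close>

lemma Spec_H_cos_path_angle: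
  fixes X :: "nat mixed_graph"
  assumes "verts X = {0..<n}"
    and "\<And>s. s \<in> {1..n} \<Longrightarrow> eigenvalue (herm_adj X) (complex_of_real (2 * cos (path_angle n s)))"
  shows "Spec_H X = mset_set ((\<lambda>s. complex_of_real (2 * cos (path_angle n s))) ` {1..n})"
  unfolding Spec_H_def
proof (rule proots_char_poly_eq_mset_set)
  show "herm_adj X \<in> carrier_mat n n"
    by (simp add: herm_adj_atLeast0LessThan[OF assms(1)])
  show "card ((\<lambda>s. complex_of_real (2 * cos (path_angle n s))) ` {1..n}) = n"
    using card_image[OF inj_on_cos_path_angle[of n]] by simp
qed (use assms(2) in auto)

section \<open>Eigenvectors of the path and of its mate\<close>

lemma eigenvalue_path:
  assumes s: "s \<in> {1..n}"
  shows "eigenvalue (herm_adj (path n)) (complex_of_real (2 * cos (path_angle n s)))"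
proof -
  define t where "t = path_angle n s"
  \<comment> \<open>The shift by one puts zeros of the sine at the imaginary neighbours -1 and
    \<open>n\<close> of the two ends, so the boundary rows obey the same recurrence.\<close>
  define f where "f u = complex_of_real (sin (real (Suc u) * t))" for u
  have step: "f u + f (Suc (Suc u)) = complex_of_real (2 * cos t) * f (Suc u)" for u
    using sin_plus_sin_Suc_Suc[of "Suc u" t] unfolding f_def
    by (simp only: of_real_add[symmetric] of_real_mult[symmetric])
  have start: "f (Suc 0) = complex_of_real (2 * cos t) * f 0"
    using sin_plus_sin_Suc_Suc[of 0 t] unfolding f_def
    by (simp only: of_real_mult[symmetric]) simp
  have "real (Suc n) * t = real s * pi"
    by (simp add: t_def path_angle_def field_simps)
  then have stop: "f n = 0"
    by (simp only: f_def) (simp add: sin_npi)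
  have "eigenvalue (herm_adj (path n)) (complex_of_real (2 * cos t))"
  proof (rule eigenvalue_herm_adj)
    show "verts (path n) = {0..<n}" by (simp add: path_def)
    show "0 < n" using s by simp
    show "f 0 \<noteq> 0"
      using sin_gt_zero path_angle_bounds[OF s] by (fastforce simp: f_def t_def)
    fix u assume u: "u < n"
    have "(if u = 0 then 0 else f (u - 1)) + (if Suc u < n then f (Suc u) else 0) =
      (if u = 0 then 0 else f (u - 1)) + f (Suc u)"
      using stop u by (auto simp: not_less le_Suc_eq dest: le_antisym)
    also have "\<dots> = complex_of_real (2 * cos t) * f u"
      using step start by (cases u) auto
    finally show "(\<Sum>w\<in>{0..<n}. herm_entry (path n) u w * f w) =
        complex_of_real (2 * cos t) * f u"
      using u by (simp only: sum_herm_entry_path)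
  qed
  then show ?thesis by (simp only: t_def)
qed

text \<open>For even \<open>s\<close> the angle equals \<open>(s div 2) * pi / (2 * k + 2)\<close>,
  which belongs to the path on \<open>2 * k + 1\<close> vertices. Its sine vector, extended by zero,
  stays an eigenvector because no edge leaves that component.\<close>

lemma eigenvalue_path_cycle_even:
  assumes k: "k \<ge> 1" and s: "s \<in> {1..4 * k + 3}" and "even s"
  shows "eigenvalue (herm_adj (path_cycle k))
    (complex_of_real (2 * cos (path_angle (4 * k + 3) s)))"
proof -
  define t where "t = path_angle (4 * k + 3) s"
  define f where
    "f u = (if u \<le> 2 * k then complex_of_real (sin (real (Suc u) * t)) else 0)" for u
  have "real (2 * k + 2) * t = real (s div 2) * pi"
  proof -
    have "real s = 2 * real (s div 2)" using \<open>even s\<close> by (auto elim!: evenE)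
    then show ?thesis by (simp add: t_def path_angle_def field_simps)
  qed
  then have stop: "sin (real (2 * k + 2) * t) = 0"
    by (simp only: sin_npi)
  have step: "f u + f (Suc (Suc u)) = complex_of_real (2 * cos t) * f (Suc u)"
    if "Suc u \<le> 2 * k" for u
  proof -
    \<comment> \<open>The recurrence survives the cut-off: for \<open>Suc u = 2 * k\<close> the left
      side is 0 by the definition of \<open>f\<close>, and the sine is 0 by
      \<open>stop\<close>.\<close>
    have "f (Suc (Suc u)) = complex_of_real (sin (real (Suc (Suc (Suc u))) * t))"
    proof (cases "Suc u = 2 * k")
      case True
      then have *: "2 * k + 2 = Suc (Suc (Suc u))" by simp
      have "f (Suc (Suc u)) = 0" unfolding f_def using True by simp
      then show ?thesis using stop[unfolded *] by (simp only: of_real_0)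
    qed (use that in \<open>simp add: f_def\<close>)
    then show ?thesis
      using sin_plus_sin_Suc_Suc[of "Suc u" t] that
      by (simp only: f_def of_real_add[symmetric] of_real_mult[symmetric] if_True Suc_leD)
  qed
  have start: "f (Suc 0) = complex_of_real (2 * cos t) * f 0"
    using sin_plus_sin_Suc_Suc[of 0 t] k unfolding f_def
    by (simp flip: of_real_mult)
  have "eigenvalue (herm_adj (path_cycle k)) (complex_of_real (2 * cos t))"
  proof (rule eigenvalue_herm_adj[OF verts_path_cycle])
    show "0 < 4 * k + 3" by simp
    show "f 0 \<noteq> 0"
      using sin_gt_zero path_angle_bounds[OF s] by (fastforce simp: f_def t_def)
    fix u assume u: "u < 4 * k + 3"
    consider "u = 0" | v where "u = Suc v" "Suc v \<le> 2 * k" | "u = 2 * k + 1" | "u > 2 * k + 1"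
      by (metis Suc_eq_plus1 linorder_neqE_nat less_Suc_eq_le not0_implies_Suc)
    then show "(\<Sum>w\<in>{0..<4 * k + 3}. herm_entry (path_cycle k) u w * f w) =
        complex_of_real (2 * cos t) * f u"
    proof cases
      case 1
      then show ?thesis unfolding sum_herm_entry_path_cycle[OF k u] using start k by simp
    next
      case 2
      have "f (2 * k + 1) = 0" by (simp add: f_def)
      with 2 show ?thesis unfolding sum_herm_entry_path_cycle[OF k u] using step[of v] k
        by (auto split: if_splits)
    next
      case 3
      then show ?thesis unfolding sum_herm_entry_path_cycle[OF k u] using k by (simp add: f_def)
    next
      case 4
      then have "\<not> u - 1 \<le> 2 * k" by linarith
      with 4 show ?thesis unfolding sum_herm_entry_path_cycle[OF k u] using k
        by (simp add: f_def)
    qed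
  qed
  then show ?thesis by (simp only: t_def)
qed

text \<open>The powers of \<open>z\<close> satisfy the inner rows with eigenvalue
  \<open>z + inverse z\<close>. One turn around the cycle multiplies them by
  \<open>z ^ (2 * k + 2) = \<i>\<close>, exactly the weight of the arc, so the two rows at the arc
  fit as well.\<close>

lemma eigenvalue_path_cycle_root:
  assumes k: "k \<ge> 1" and z: "z ^ (2 * k + 2) = \<i>"
  shows "eigenvalue (herm_adj (path_cycle k)) (z + inverse z)"
proof -
  have z0: "z \<noteq> 0" using z by (auto simp: power_0_left)
  define f where "f u = (if u \<le> 2 * k then 0 else z ^ u)" for u
  have step: "z ^ v + z ^ Suc (Suc v) = (z + inverse z) * z ^ Suc v" for v
    using z0 by (simp add: field_simps)
  have z1: "z ^ (4 * k + 2) = \<i> * z ^ (2 * k)" "z ^ (4 * k + 3) = \<i> * z ^ (2 * k + 1)"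
  proof -
    have "4 * k + 2 = (2 * k + 2) + 2 * k" "4 * k + 3 = (2 * k + 2) + (2 * k + 1)" by simp_all
    then show "z ^ (4 * k + 2) = \<i> * z ^ (2 * k)" "z ^ (4 * k + 3) = \<i> * z ^ (2 * k + 1)"
      by (metis power_add z)+
  qed
  show ?thesis
  proof (rule eigenvalue_herm_adj[OF verts_path_cycle])
    show "4 * k + 2 < 4 * k + 3" by simp
    show "f (4 * k + 2) \<noteq> 0" using z0 by (simp add: f_def)
    fix u assume u: "u < 4 * k + 3"
    \<comment> \<open>On the cycle: first vertex, last vertex, inner vertices, each written as
      \<open>Suc v\<close> to match \<open>step\<close>.\<close>
    consider "u \<le> 2 * k" | v where "u = Suc v" "v = 2 * k"
      | v where "u = Suc v" "v = 4 * k + 1"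
      | v where "u = Suc v" "v > 2 * k" "v < 4 * k + 1"
    proof -
      have "u \<le> 2 * k \<or> (\<exists>v. u = Suc v \<and> (v = 2 * k \<or> v = 4 * k + 1 \<or> v > 2 * k \<and> v < 4 * k + 1))"
        using u by (cases u) auto
      then show thesis using that by blast
    qed
    then show "(\<Sum>w\<in>{0..<4 * k + 3}. herm_entry (path_cycle k) u w * f w) =
        (z + inverse z) * f u"
    proof cases
      case 1
      then have "u - 1 \<le> 2 * k" by simp
      with 1 show ?thesis unfolding sum_herm_entry_path_cycle[OF k u] using k
        by (simp add: f_def)
    next
      case 2
      have "- \<i> * z ^ (4 * k + 2) = z ^ v" unfolding z1 2 by simp
      with 2 show ?thesis unfolding sum_herm_entry_path_cycle[OF k u] using k step[of v]
        by (simp add: f_def)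
    next
      case 3
      have pow: "\<i> * z ^ (2 * k + 1) = z ^ Suc (Suc v)"
        using z1 3 by (simp add: eval_nat_numeral)
      have f: "f v = z ^ v" "f (Suc v) = z ^ Suc v" "f (2 * k + 1) = z ^ (2 * k + 1)"
        using 3 by (simp_all add: f_def)
      have "(\<Sum>w\<in>{0..<4 * k + 3}. herm_entry (path_cycle k) u w * f w) =
          f v + \<i> * f (2 * k + 1)"
        unfolding sum_herm_entry_path_cycle[OF k u] using 3 k by simp
      also have "\<dots> = (z + inverse z) * f u"
        by (simp only: f pow step 3(1))
      finally show ?thesis .
    next
      case 4
      then show ?thesis unfolding sum_herm_entry_path_cycle[OF k u] using k step[of v]
        by (simp add: f_def)
    qed
  qed
qed

text \<open>With \<open>z = cis t\<close> the power \<open>z ^ (2 * k + 2)\<close> is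
  \<open>\<i> ^ s\<close>, which is \<open>\<i>\<close> or \<open>- \<i>\<close> for odd
  \<open>s\<close>. In the second case the conjugate, given by the sign \<open>e = - 1\<close>, is
  the required root; both signs yield the sum \<open>2 * cos t\<close>.\<close>

lemma eigenvalue_path_cycle_odd:
  assumes k: "k \<ge> 1" and "odd s"
  shows "eigenvalue (herm_adj (path_cycle k))
    (complex_of_real (2 * cos (path_angle (4 * k + 3) s)))"
proof -
  define t where "t = path_angle (4 * k + 3) s"
  have t: "real (2 * k + 2) * t = real s * pi / 2"
    by (simp add: t_def path_angle_def field_simps)
  have pow: "cis (e * t) ^ (2 * k + 2) = cis (e * (real s * pi / 2))" for e
    unfolding DeMoivre t[symmetric] by (simp only: ac_simps)
  have "\<exists>e\<in>{1, - 1}. cis (e * (real s * pi / 2)) = \<i>"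
  proof -
    have "cis (real s * pi / 2) = \<i> ^ s"
      using DeMoivre[of "pi / 2" s] by (simp add: algebra_simps)
    moreover have "\<i> ^ s = \<i> \<or> \<i> ^ s = - \<i>"
    proof -
      obtain b where "s = 2 * b + 1" using \<open>odd s\<close> by (rule oddE)
      then have "\<i> ^ s = \<i> * (- 1) ^ b" by (simp add: power_mult)
      then show ?thesis by (cases "even b") auto
    qed
    ultimately consider "cis (real s * pi / 2) = \<i>" | "cis (real s * pi / 2) = - \<i>"
      by metis
    then show ?thesis
    proof cases
      case 2
      have "cis (- 1 * (real s * pi / 2)) = cnj (cis (real s * pi / 2))"
        by (simp add: cis_cnj)
      with 2 have "cis (- 1 * (real s * pi / 2)) = \<i>" by simp
      then show ?thesis by blast
    qed simp
  qed
  then obtain e :: real where e: "e \<in> {1, - 1}" "cis (e * t) ^ (2 * k + 2) = \<i>"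
    using pow by metis
  have "cis (e * t) + inverse (cis (e * t)) = complex_of_real (2 * cos t)"
    using e(1) by (auto simp: complex_eq_iff)
  with eigenvalue_path_cycle_root[OF k e(2)] show ?thesis
    by (simp only: t_def)
qed

lemma Spec_H_path_cycle:
  assumes "k \<ge> 1"
  shows "Spec_H (path_cycle k) = Spec_H (path (4 * k + 3))"
proof -
  have "verts (path (4 * k + 3)) = {0..<4 * k + 3}" by (simp add: path_def)
  from Spec_H_cos_path_angle[OF this eigenvalue_path] show ?thesis
    using Spec_H_cos_path_angle[OF verts_path_cycle]
      eigenvalue_path_cycle_even[OF assms] eigenvalue_path_cycle_odd[OF assms]
    by metis
qed

section \<open>Disconnectedness against switching and isomorphism\<close>

text \<open>Rewriting the equation as \<open>D * A = B * D\<close> reduces each entry to one term: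
  \<open>A\<close> and \<open>B\<close> differ at \<open>(u, v)\<close> only by a quotient of
  diagonal entries of \<open>D\<close>, which are nonzero.\<close>

lemma switching_equivalent_adjacent:
  fixes X Y :: "nat mixed_graph"
  assumes sw: "switching_equivalent X Y" and X: "verts X = {0..<n}"
    and uv: "u < n" "v < n" and nz: "herm_entry Y u v \<noteq> 0"
  shows "herm_entry X u v \<noteq> 0"
proof -
  have Y: "verts Y = {0..<n}"
    using sw X by (simp add: switching_equivalent_def)
  have [simp]: "card (verts X) = n"
    using X by simp
  obtain D D' where D: "D \<in> carrier_mat n n" "D' \<in> carrier_mat n n" "diagonal_mat D"
    "\<forall>j<n. D $$ (j, j) \<in> {1, - 1, \<i>, - \<i>}" "inverts_mat D D'"
    and eq: "herm_adj X = D' * herm_adj Y * D"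
    using sw by (auto simp: switching_equivalent_def Let_def)
  define A B where "A = herm_adj X" and "B = herm_adj Y"
  have AB: "A \<in> carrier_mat n n" "B \<in> carrier_mat n n"
    "A $$ (u, v) = herm_entry X u v" "B $$ (u, v) = herm_entry Y u v"
    using uv by (auto simp: A_def B_def herm_adj_atLeast0LessThan[OF X]
        herm_adj_atLeast0LessThan[OF Y])
  have "D * A = D * (D' * (B * D))"
    using AB D by (simp add: eq A_def B_def assoc_mult_mat[of _ n n _ n _ n])
  also have "\<dots> = (D * D') * (B * D)"
    using AB D by (intro assoc_mult_mat[symmetric]) auto
  also have "\<dots> = B * D"
    using AB D by (auto simp: inverts_mat_def)
  finally have "(D * A) $$ (u, v) = (B * D) $$ (u, v)" by simp
  moreover have "(D * A) $$ (u, v) = D $$ (u, u) * A $$ (u, v)"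
  proof -
    have "(D * A) $$ (u, v) = (\<Sum>j\<in>{0..<n}. D $$ (u, j) * A $$ (j, v))"
      using AB D uv by (auto simp: scalar_prod_def)
    also have "\<dots> = (\<Sum>j\<in>{u}. D $$ (u, j) * A $$ (j, v))"
      using D uv by (intro sum.mono_neutral_right) (auto simp: diagonal_mat_def)
    finally show ?thesis by simp
  qed
  moreover have "(B * D) $$ (u, v) = B $$ (u, v) * D $$ (v, v)"
  proof -
    have "(B * D) $$ (u, v) = (\<Sum>j\<in>{0..<n}. B $$ (u, j) * D $$ (j, v))"
      using AB D uv by (auto simp: scalar_prod_def)
    also have "\<dots> = (\<Sum>j\<in>{v}. B $$ (u, j) * D $$ (j, v))"
      using D uv by (intro sum.mono_neutral_right) (auto simp: diagonal_mat_def)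
    finally show ?thesis by simp
  qed
  moreover have "D $$ (v, v) \<noteq> 0" using D(4) uv by fastforce
  ultimately show ?thesis using nz AB by auto
qed

text \<open>An isomorphism to the path would list all vertices so that consecutive ones are adjacent
  in \<open>Z\<close>, hence in \<open>path_cycle k\<close>. Such a list never changes component,
  yet must reach both.\<close>

lemma path_cycle_not_switching_isomorphic_path:
  assumes k: "k \<ge> 1" and sw: "switching_equivalent (path_cycle k) Z"
  shows "\<not> isomorphic Z (path (4 * k + 3))"
proof
  let ?n = "4 * k + 3"
  assume "isomorphic Z (path ?n)"
  moreover have Z: "verts Z = {0..<?n}"
    using sw by (simp add: switching_equivalent_def verts_path_cycle)
  ultimately obtain f where f: "bij_betw f {0..<?n} {0..<?n}"
    and adj: "\<And>u v. u < ?n \<Longrightarrow> v < ?n \<Longrightarrow>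
      {u, v} \<in> edges Z \<longleftrightarrow> {f u, f v} \<in> edges (path ?n)"
    by (auto simp: isomorphic_def path_def)
  \<comment> \<open>\<open>g j\<close> is the vertex of \<open>Z\<close> at position
    \<open>j\<close> of the path.\<close>
  define g where "g = inv_into {0..<?n} f"
  have g: "bij_betw g {0..<?n} {0..<?n}"
    unfolding g_def by (rule bij_betw_inv_into[OF f])
  then have g_less: "g j < ?n" if "j < ?n" for j
    using that bij_betwE by fastforce
  have fg: "f (g j) = j" if "j < ?n" for j
    using that f unfolding g_def by (simp add: bij_betw_inv_into_right)
  have step: "g (Suc j) \<le> 2 * k \<longleftrightarrow> g j \<le> 2 * k" if j: "Suc j < ?n" for j
  proof -
    have "{g j, g (Suc j)} \<in> edges Z"
      using adj[of "g j" "g (Suc j)"] j g_less fg by (auto simp: path_def)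
    then have "herm_entry Z (g j) (g (Suc j)) \<noteq> 0" by (simp add: herm_entry_def)
    then have "herm_entry (path_cycle k) (g j) (g (Suc j)) \<noteq> 0"
      using j g_less by (intro switching_equivalent_adjacent[OF sw verts_path_cycle]) auto
    with herm_entry_path_cycle_nonzero[OF k] show ?thesis
      using j g_less[of j] g_less[of "Suc j"] by simp
  qed
  have const: "g j \<le> 2 * k \<longleftrightarrow> g 0 \<le> 2 * k" if "j < ?n" for j
    using that by (induction j) (use step in auto)
  \<comment> \<open>One vertex from each component.\<close>
  have "0 \<in> g ` {0..<?n}" "2 * k + 1 \<in> g ` {0..<?n}"
    using g by (auto simp: bij_betw_def)
  then obtain a b where "a < ?n" "g a = 0" "b < ?n" "g b = 2 * k + 1"
    by (metis atLeastLessThan_iff imageE)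
  with const[of a] const[of b] show False by simp
qed

theorem theorem3p18:
  fixes k :: nat
  assumes "k \<ge> 1"
  shows "\<not> DHS (path (4 * k + 3))"
proof
  assume "DHS (path (4 * k + 3))"
  then obtain Z where "switching_equivalent (path_cycle k) Z" "isomorphic Z (path (4 * k + 3))"
    using mixed_graph_path_cycle[OF assms] Spec_H_path_cycle[OF assms]
    unfolding DHS_def by metis
  then show False
    using path_cycle_not_switching_isomorphic_path[OF assms] by metis
qed

end
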